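(* For integers $s,k\ge1$ and every $n\in\mathbb N$, $$\frac{J_k(n)}{n^k}=\sum_{q\ge1}\frac{\mu(q)}{\zeta(s+k)\,J_{s+k}(q)}\,c_q^{(s)}(n^s).$$
   Context: $J_k$ is the Jordan totient function: $J_k(n)=n^k\prod_{p\mid n}(1-p^{-k})$. $\mu$ is the Möbius function and $\zeta$ the Riemann zeta function. For a positive integer $s$ and integers $m,n$ not both zero, $(m,n)_s$ is the largest $l^s$ ($l\in\mathbb N$) dividing both; the Cohen-Ramanujan sum is $c_q^{(s)}(n)=\sum_{1\le a\le q^s,\ (a,q^s)_s=1} e^{2\pi i n a/q^s}$. *)

theory Defs
  imports "HOL-Analysis.Analysis" "HOL-Computational_Algebra.Computational_Algebra"
begin

definition moebius_mu :: "nat \<Rightarrow> int" where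
  "moebius_mu n = (if squarefree n then (-1) ^ card (prime_factors n) else 0)"

definition jordan_totient :: "nat \<Rightarrow> nat \<Rightarrow> real" where
  "jordan_totient k n = real n ^ k * (\<Prod>p\<in>prime_factors n. (1 - 1 / real p ^ k))"

text \<open>
  The Dirichlet series represents the Riemann zeta function only for \<open>Re z > 1\<close>; it is
  evaluated here only at integers \<open>\<ge> 2\<close>.
\<close>

definition riemann_zeta :: "complex \<Rightarrow> complex" where
  "riemann_zeta z = (\<Sum>n. 1 / of_nat (Suc n) powr z)"

text \<open>
  \<open>gen_gcd s m n\<close> is the generalised gcd \<open>(m, n)\<^sub>s\<close>. It is meaningful only for \<open>s \<ge> 1\<close> and
  \<open>m\<close>, \<open>n\<close> not both zero; otherwise the set below may be infinite.
\<close>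

definition gen_gcd :: "nat \<Rightarrow> int \<Rightarrow> int \<Rightarrow> int" where
  "gen_gcd s m n = Max {int l ^ s | l. 0 < l \<and> int l ^ s dvd m \<and> int l ^ s dvd n}"

text \<open>\<open>cohen_ramanujan s q n\<close> is the sum \<open>c\<^sub>q\<^sup>(\<^sup>s\<^sup>)(n)\<close>.\<close>

definition cohen_ramanujan :: "nat \<Rightarrow> nat \<Rightarrow> int \<Rightarrow> complex" where
  "cohen_ramanujan s q n =
     (\<Sum>a | 1 \<le> a \<and> a \<le> int q ^ s \<and> gen_gcd s a (int q ^ s) = 1.
        exp (2 * of_real pi * \<i> * of_int n * of_int a / of_nat q ^ s))"

end

theory Submission
  imports Defs
begin

text \<open>
  Put \<open>t = s + k\<close>. For squarefree \<open>q\<close> the factor \<open>1 / J\<^sub>t(q) = \<Prod>\<^sub>p\<^sub>|\<^sub>q 1 / (p\<^sup>t - 1)\<close> expands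
  geometrically into the sum of \<open>m\<^sup>-\<^sup>t\<close> over all \<open>m\<close> with radical \<open>q\<close>, and
  \<open>\<mu>(q) c\<^sub>q(n\<^sup>s)\<close> is the sum of \<open>\<mu>(d) d\<^sup>s\<close> over the common divisors \<open>d\<close> of \<open>q\<close> and \<open>n\<close>.
  A squarefree \<open>d\<close> divides \<open>m\<close> iff it divides the radical of \<open>m\<close>, so interchanging the sums gives
  \<open>\<Sum>\<^sub>d\<^sub>|\<^sub>n \<mu>(d) d\<^sup>s \<Sum>\<^sub>d\<^sub>|\<^sub>m m\<^sup>-\<^sup>t = \<zeta>(t) \<Sum>\<^sub>d\<^sub>|\<^sub>n \<mu>(d) d\<^sup>-\<^sup>k = \<zeta>(t) J\<^sub>k(n) / n\<^sup>k\<close>.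
\<close>

section \<open>Squarefree numbers and Moebius sums\<close>

lemma prime_factors_prod_primes:
  fixes P :: "nat set"
  assumes "finite P" "\<And>p. p \<in> P \<Longrightarrow> prime p"
  shows "prime_factors (\<Prod>P) = P"
proof -
  have "prime_factors (\<Prod>P) = (\<Union>p\<in>P. prime_factors p)"
    using assms by (subst prime_factors_prod) (auto dest: assms(2))
  also have "\<dots> = P"
    using assms by (auto simp: prime_prime_factors)
  finally show ?thesis .
qed

lemma squarefree_prod_primes:
  fixes P :: "nat set"
  assumes "\<And>p. p \<in> P \<Longrightarrow> prime p"
  shows "squarefree (\<Prod>P)"
  by (rule squarefree_prod_coprime) (auto intro: assms primes_coprime squarefree_prime)

text \<open>Each prime of a squarefree \<open>d\<close> has multiplicity 1, so divisibility asks
  only that these primes occur in \<open>m\<close>. Thus \<open>d\<close> cannot distinguish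
  \<open>m\<close> from its radical.\<close>

lemma squarefree_dvd_iff_prime_factors_subset:
  fixes d m :: nat
  assumes "squarefree d" "m > 0"
  shows "d dvd m \<longleftrightarrow> prime_factors d \<subseteq> prime_factors m"
proof
  assume "d dvd m"
  with assms show "prime_factors d \<subseteq> prime_factors m"
    by (intro dvd_prime_factors) auto
next
  assume sub: "prime_factors d \<subseteq> prime_factors m"
  have "d \<noteq> 0" using assms by (metis not_squarefree_0)
  have "multiplicity p d \<le> multiplicity p m" if "prime p" for p
  proof (cases "p \<in> prime_factors d")
    case True
    then have "multiplicity p d = 1"
      using assms \<open>d \<noteq> 0\<close> by (simp add: squarefree_factorial_semiring')
    moreover have "multiplicity p m > 0"
      using True sub by (auto simp: prime_factors_multiplicity)
    ultimately show ?thesis by simp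
  qed (use that in \<open>auto simp: prime_factors_multiplicity\<close>)
  with \<open>d \<noteq> 0\<close> show "d dvd m"
    by (intro multiplicity_le_imp_dvd) auto
qed

lemma squarefree_eqI_prime_factors:
  fixes a b :: nat
  assumes "squarefree a" "squarefree b" "prime_factors a = prime_factors b"
  shows "a = b"
  by (metis assms dvd_antisym gr0I not_squarefree_0 order_refl
      squarefree_dvd_iff_prime_factors_subset)

lemma squarefree_prod_prime_factors:
  fixes q :: nat
  assumes "squarefree q"
  shows "\<Prod>(prime_factors q) = q"
  by (rule squarefree_eqI_prime_factors)
     (auto simp: assms prime_factors_prod_primes in_prime_factors_imp_prime
           intro!: squarefree_prod_primes)

text \<open>In \<open>q = d * e\<close> the factors are coprime, so mu(q) = mu(d) mu(e), and mu(e)^2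
  = 1 cancels. This turns the coefficient mu(q/d) of a Cohen-Ramanujan sum into one independent of
  \<open>q\<close>.\<close>

lemma moebius_mu_mult_div:
  assumes "squarefree q" "d dvd q"
  shows "moebius_mu q * moebius_mu (q div d) = moebius_mu d"
proof -
  obtain e where q: "q = d * e" using assms(2) by auto
  have nz: "d \<noteq> 0" "e \<noteq> 0"
    using assms q by (metis mult_zero_left not_squarefree_0, metis mult_zero_right not_squarefree_0)
  have sf: "squarefree d" "squarefree e"
    using assms q by (auto dest: squarefree_multD)
  have "prime_factors d \<inter> prime_factors e = {}"
  proof (rule ccontr)
    assume "prime_factors d \<inter> prime_factors e \<noteq> {}"
    then obtain p where p: "prime p" "p dvd d" "p dvd e" by auto
    then have "p ^ 2 dvd q" by (simp add: q power2_eq_square mult_dvd_mono)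
    with assms p show False by (auto dest: squarefreeD)
  qed
  then have "card (prime_factors q) = card (prime_factors d) + card (prime_factors e)"
    using nz by (simp add: q prime_factors_product card_Un_disjoint)
  with assms sf nz show ?thesis
    by (simp add: moebius_mu_def q power_add flip: power_mult_distrib)
qed

text \<open>Only squarefree divisors contribute; they correspond to the subsets of the primes of
  \<open>n\<close>, and the sum over subsets is the expanded product. It serves twice: with
  \<open>f\<close> an indicator, to sieve out the generalised gcd condition, and with f(d) = d^-k,
  to produce J_k(n)/n^k.\<close>

lemma sum_moebius_mu_multiplicative:
  fixes f :: "nat \<Rightarrow> 'a :: comm_ring_1"
  assumes "n > 0" and one: "f 1 = 1"
    and mult: "\<And>a b. coprime a b \<Longrightarrow> f (a * b) = f a * f b"
  shows "(\<Sum>d | d dvd n. of_int (moebius_mu d) * f d) = (\<Prod>p\<in>prime_factors n. 1 - f p)"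
proof -
  let ?P = "prime_factors n"
  have fin: "finite {d. d dvd n}" using assms(1) by simp
  have f_prod: "f (\<Prod>X) = (\<Prod>p\<in>X. f p)" if "finite X" "\<And>p. p \<in> X \<Longrightarrow> prime p" for X
    using that
  proof (induction X rule: finite_induct)
    case (insert p X)
    have "coprime p (\<Prod>X)"
      using insert.hyps insert.prems by (intro prod_coprime_right primes_coprime) auto
    then show ?case using insert by (simp add: mult)
  qed (simp add: one[simplified])
  have "(\<Sum>d | d dvd n. of_int (moebius_mu d) * f d) =
        (\<Sum>d | d dvd n \<and> squarefree d. of_int (moebius_mu d) * f d)"
    using fin by (intro sum.mono_neutral_right) (auto simp: moebius_mu_def)
  also have "\<dots> = (\<Sum>X\<in>Pow ?P. (-1) ^ card X * (\<Prod>p\<in>X. f p))"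
  proof (rule sum.reindex_bij_witness[of _ "\<lambda>X. \<Prod>X" prime_factors])
    fix d assume d: "d \<in> {d. d dvd n \<and> squarefree d}"
    then show pr: "\<Prod>(prime_factors d) = d" by (simp add: squarefree_prod_prime_factors)
    show "prime_factors d \<in> Pow ?P"
      using d assms(1) squarefree_dvd_iff_prime_factors_subset[of d n] by blast
    have "f d = (\<Prod>p\<in>prime_factors d. f p)"
      using f_prod[of "prime_factors d"] pr by auto
    with d show "(-1) ^ card (prime_factors d) * (\<Prod>p\<in>prime_factors d. f p) =
        of_int (moebius_mu d) * f d"
      by (simp add: moebius_mu_def)
  next
    fix X assume X: "X \<in> Pow ?P"
    then have pX: "finite X" "\<And>p. p \<in> X \<Longrightarrow> prime p"
      by (auto dest: finite_subset)
    show "prime_factors (\<Prod>X) = X" using pX by (rule prime_factors_prod_primes)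
    then show "\<Prod>X \<in> {d. d dvd n \<and> squarefree d}"
      using X pX assms(1)
      by (auto simp: squarefree_dvd_iff_prime_factors_subset squarefree_prod_primes)
  qed
  also have "\<dots> = (\<Prod>p\<in>?P. 1 - f p)"
    by (simp add: prod_diff_conv_sum)
  finally show ?thesis .
qed

section \<open>Cohen-Ramanujan sums as divisor sums\<close>

lemma gen_gcd_eq_1_iff:
  assumes "s \<ge> 1" "q > 0"
  shows "gen_gcd s a (int q ^ s) = 1 \<longleftrightarrow> (\<forall>p\<in>prime_factors q. \<not> int p ^ s dvd a)"
proof -
  define S where "S = {int l ^ s | l. 0 < l \<and> int l ^ s dvd a \<and> int l ^ s dvd int q ^ s}"
  \<comment> \<open>\<open>Max\<close> is meaningful only on a finite set. Since
    \<open>s \<ge> 1\<close> and \<open>q > 0\<close>, the condition that l^s divides q^s bounds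
    \<open>l\<close> by \<open>q\<close>, even when \<open>a = 0\<close>.\<close>
  have "S \<subseteq> (\<lambda>l. int l ^ s) ` {..q}"
    using assms by (auto simp: S_def dvd_imp_le)
  then have fin: "finite S" by (rule finite_subset) simp
  have one: "1 \<in> S" unfolding S_def by (auto intro!: exI[of _ 1])
  have "Max S = 1 \<longleftrightarrow> (\<forall>x\<in>S. x \<le> 1)"
    using fin one by (metis Max_eq_iff empty_iff)
  also have "\<dots> \<longleftrightarrow> (\<forall>p\<in>prime_factors q. \<not> int p ^ s dvd a)"
  proof (intro iffI ballI notI)
    fix p assume *: "\<forall>x\<in>S. x \<le> 1" "p \<in> prime_factors q" "int p ^ s dvd a"
    then have p: "prime p" "p dvd q" by auto
    then have "int p ^ s \<in> S"
      using * assms by (auto simp: S_def prime_gt_0_nat intro!: exI[of _ p])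
    moreover have "int p ^ s > 1"
      using prime_gt_1_nat[OF p(1)] assms by (intro one_less_power) auto
    ultimately show False using * by force
  next
    fix x assume *: "\<forall>p\<in>prime_factors q. \<not> int p ^ s dvd a" "x \<in> S"
    then obtain l where l: "x = int l ^ s" "l > 0" "int l ^ s dvd a" "l dvd q"
      using assms by (auto simp: S_def)
    \<comment> \<open>A common s-th power with base other than 1 yields one with prime base: any
      prime dividing \<open>l\<close> will do.\<close>
    have "l = 1"
    proof (rule ccontr)
      assume "l \<noteq> 1"
      then obtain p where p: "prime p" "p dvd l" using prime_factor_nat by blast
      then have "int p ^ s dvd int l ^ s" using assms by simp
      then have "int p ^ s dvd a" using l by (blast intro: dvd_trans)
      moreover have "p \<in> prime_factors q"
        using p l assms by (auto simp: prime_factors_dvd)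
      ultimately show False using * by blast
    qed
    then show "x \<le> 1" using l by simp
  qed
  finally show ?thesis by (simp add: gen_gcd_def S_def)
qed

text \<open>Orthogonality of additive characters modulo \<open>M\<close>: the terms are powers of an
  M-th root of unity \<open>w\<close>, which is 1 exactly when \<open>M\<close> divides
  \<open>N\<close>; otherwise the geometric sum has numerator w^M - 1 = 0.\<close>

lemma sum_exp_multiples:
  fixes N :: int and M :: nat
  assumes "M > 0"
  shows "(\<Sum>b\<in>{1..int M}. exp (2 * of_real pi * \<i> * of_int N * of_int b / of_nat M) :: complex) =
         (if int M dvd N then of_nat M else 0)"
proof -
  define w :: complex where "w = exp (2 * of_real pi * \<i> * of_int N / of_nat M)"
  have "(\<Sum>b\<in>{1..int M}. exp (2 * of_real pi * \<i> * of_int N * of_int b / of_nat M) :: complex)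
      = (\<Sum>j<M. w ^ Suc j)"
    by (rule sum.reindex_bij_witness[of _ "\<lambda>j. int (Suc j)" "\<lambda>b. nat (b - 1)"])
       (auto simp: w_def Suc_nat_eq_nat_zadd1 simp flip: exp_of_nat_mult intro!: arg_cong[of _ _ exp])
  \<comment> \<open>Starting at \<open>b = 1\<close> leaves an extra factor \<open>w\<close>. It is
    harmless: it equals 1 in the first case below and multiplies a vanishing sum in the
    second.\<close>
  also have "\<dots> = w * (\<Sum>j<M. w ^ j)" by (simp add: sum_distrib_left)
  also have "\<dots> = (if int M dvd N then of_nat M else 0)"
  proof (cases "int M dvd N")
    case True
    then obtain c where "N = int M * c" by auto
    then have "w = exp (2 * of_real pi * \<i> * of_int c)" using assms by (simp add: w_def mult_ac)
    then have "w = 1" by (simp add: exp_eq_1)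
    with True show ?thesis by simp
  next
    case False
    have "w ^ M = exp (2 * of_real pi * \<i> * of_int N)"
      using assms by (simp add: w_def flip: exp_of_nat_mult)
    then have wM: "w ^ M = 1" by (simp add: exp_eq_1)
    have "w \<noteq> 1"
    proof
      assume "w = 1"
      then obtain c :: int where "2 * pi * real_of_int N / real M = of_int (2 * c) * pi"
        by (auto simp: w_def exp_eq_1)
      then have "real_of_int N = real_of_int (int M * c)" using assms by (simp add: field_simps)
      then have "N = int M * c" using of_int_eq_iff by blast
      with False show False by simp
    qed
    then have "(\<Sum>j<M. w ^ j) = 0" using wM by (simp add: geometric_sum)
    with False show ?thesis by simp
  qed
  finally show ?thesis .
qed

text \<open>The gcd condition is detected by a Moebius sum over the \<open>l\<close> dividing
  \<open>q\<close> with l^s dividing \<open>a\<close>. After swapping sums, each \<open>l\<close>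
  leaves a complete character sum modulo d^s with d = q/l, which vanishes unless d^s divides
  n^s.\<close>

lemma cohen_ramanujan_eq_divisor_sum:
  assumes "s \<ge> 1" "q > 0"
  shows "cohen_ramanujan s q (int n ^ s) =
    (\<Sum>d | d dvd q. of_int (moebius_mu (q div d)) * (if d dvd n then of_nat d ^ s else 0))"
proof -
  define e where "e a = exp (2 * of_real pi * \<i> * of_int (int n ^ s) * of_int a / of_nat q ^ s)" for a
  have fin: "finite {d. d dvd q}" using assms by simp
  \<comment> \<open>The sum factors over the primes p of \<open>q\<close> into terms 1 -
    [p^s divides a], all equal to 1 exactly when the generalised gcd is 1.\<close>
  have ind: "(\<Sum>l | l dvd q. of_int (moebius_mu l) * (if int l ^ s dvd a then 1 else 0 :: complex)) =
       (if gen_gcd s a (int q ^ s) = 1 then 1 else 0)" for a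
  proof -
    have "(\<Sum>l | l dvd q. of_int (moebius_mu l) * (if int l ^ s dvd a then 1 else 0 :: complex)) =
        (\<Prod>p\<in>prime_factors q. 1 - (if int p ^ s dvd a then 1 else 0))"
    proof (rule sum_moebius_mu_multiplicative)
      fix l m :: nat assume "coprime l m"
      then have "coprime (int l ^ s) (int m ^ s)" by simp
      then have "int (l * m) ^ s dvd a \<longleftrightarrow> int l ^ s dvd a \<and> int m ^ s dvd a"
        by (auto simp: power_mult_distrib intro: divides_mult dvd_mult_left dvd_mult_right)
      then show "(if int (l * m) ^ s dvd a then 1 else 0 :: complex) =
          (if int l ^ s dvd a then 1 else 0) * (if int m ^ s dvd a then 1 else 0)" by simp
    qed (use assms in auto)
    also have "\<dots> = (if \<forall>p\<in>prime_factors q. \<not> int p ^ s dvd a then 1 else 0)"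
      by (auto intro!: prod.neutral prod_zero)
    finally show ?thesis using assms by (simp add: gen_gcd_eq_1_iff)
  qed
  have "cohen_ramanujan s q (int n ^ s) =
      (\<Sum>a\<in>{1..int q ^ s}. (if gen_gcd s a (int q ^ s) = 1 then 1 else 0) * e a)"
    unfolding cohen_ramanujan_def e_def
    by (intro sum.mono_neutral_cong_left) auto
  also have "\<dots> = (\<Sum>a\<in>{1..int q ^ s}. \<Sum>l | l dvd q.
      of_int (moebius_mu l) * (if int l ^ s dvd a then e a else 0))"
    unfolding ind[symmetric] sum_distrib_right by (intro sum.cong) auto
  also have "\<dots> = (\<Sum>l | l dvd q. of_int (moebius_mu l) *
      (\<Sum>a\<in>{1..int q ^ s}. if int l ^ s dvd a then e a else 0))"
    by (subst sum.swap) (simp add: sum_distrib_left)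
  also have "\<dots> = (\<Sum>l | l dvd q. of_int (moebius_mu l) *
      (if q div l dvd n then of_nat (q div l) ^ s else 0))"
  proof (rule sum.cong)
    fix l assume "l \<in> {l. l dvd q}"
    then obtain d where q: "q = l * d" by auto
    then have pos: "l > 0" "d > 0" using assms by auto
    have "(\<Sum>a\<in>{1..int q ^ s}. if int l ^ s dvd a then e a else 0) =
        (\<Sum>a | a \<in> {1..int q ^ s} \<and> int l ^ s dvd a. e a)"
      by (subst sum.inter_filter) auto
    \<comment> \<open>Substituting \<open>a = l^s * b\<close> cancels l^s against q^s = l^s d^s in
      the exponent, and \<open>b\<close> runs over all residues modulo d^s.\<close>
    also have "\<dots> = (\<Sum>b\<in>{1..int (d ^ s)}.
        exp (2 * of_real pi * \<i> * of_int (int n ^ s) * of_int b / of_nat (d ^ s)))"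
    proof (rule sum.reindex_bij_witness[of _ "\<lambda>b. int l ^ s * b" "\<lambda>a. a div int l ^ s"])
      fix a assume "a \<in> {a. a \<in> {1..int q ^ s} \<and> int l ^ s dvd a}"
      then obtain b where a: "a = int l ^ s * b" "1 \<le> int l ^ s * b" "int l ^ s * b \<le> int q ^ s" by auto
      have pl: "int l ^ s > 0" using pos by simp
      have b: "a div int l ^ s = b" using pl a by simp
      then show "int l ^ s * (a div int l ^ s) = a" using a by simp
      have "b > 0" using a(2) pl by (smt (verit) zero_less_mult_pos)
      moreover have "b \<le> int d ^ s" using a(3) pl by (simp add: q power_mult_distrib)
      ultimately show "a div int l ^ s \<in> {1..int (d ^ s)}" unfolding b by simp
      show "exp (2 * of_real pi * \<i> * of_int (int n ^ s) * of_int (a div int l ^ s) / of_nat (d ^ s)) = e a"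
        unfolding b e_def using pos by (simp add: a(1) q power_mult_distrib field_simps)
    next
      fix b assume b: "b \<in> {1..int (d ^ s)}"
      have pl: "int l ^ s > 0" using pos by simp
      show "int l ^ s * b div int l ^ s = b" using pl by simp
      have "1 \<le> int l ^ s * b" using b pl by (smt (verit) mult_pos_pos atLeastAtMost_iff)
      then show "int l ^ s * b \<in> {a. a \<in> {1..int q ^ s} \<and> int l ^ s dvd a}"
        using b pl by (simp add: q power_mult_distrib)
    qed
    also have "\<dots> = (if int (d ^ s) dvd int n ^ s then of_nat (d ^ s) else 0)"
      using pos by (intro sum_exp_multiples) simp
    also have "\<dots> = (if d dvd n then of_nat d ^ s else 0)"
      using assms by simp
    finally show "of_int (moebius_mu l) * (\<Sum>a\<in>{1..int q ^ s}. if int l ^ s dvd a then e a else 0) =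
        of_int (moebius_mu l) * (if q div l dvd n then of_nat (q div l) ^ s else 0)"
      using pos q by simp
  qed simp
  also have "\<dots> = (\<Sum>d | d dvd q. of_int (moebius_mu (q div d)) * (if d dvd n then of_nat d ^ s else 0))"
    by (rule sum.reindex_bij_witness[of _ "\<lambda>d. q div d" "\<lambda>d. q div d"]) (use assms in auto)
  finally show ?thesis .
qed


section \<open>Sums of m^-t over integers with prescribed prime factors\<close>

lemma summable_on_inverse_power:
  assumes "t \<ge> 2"
  shows "(\<lambda>m. 1 / real m ^ t) summable_on A"
proof -
  \<comment> \<open>At \<open>m = 0\<close> the term is \<open>1 / 0 = 0\<close>, so including it
    does no harm.\<close>
  have "summable (\<lambda>m. 1 / real m ^ t)"
    using inverse_power_summable[OF assms, where 'a = real] by (simp add: divide_inverse)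
  then have "(\<lambda>m. 1 / real m ^ t) summable_on UNIV"
    by (rule summable_nonneg_imp_summable_on) simp
  then show ?thesis by (rule summable_on_subset_banach) simp
qed

text \<open>A geometric series of ratio p^-t. The exponents start at 1 because p must actually
  divide, whence p^t - 1 in the denominator.\<close>

lemma has_sum_prime_power_reciprocals:
  assumes "prime (p :: nat)" "t \<ge> 1"
  shows "((\<lambda>j. 1 / real (p ^ Suc j) ^ t) has_sum (1 / (real p ^ t - 1))) UNIV"
proof (rule sums_nonneg_imp_has_sum)
  define x where "x = 1 / real p ^ t"
  have "real p ^ t > 1"
    using prime_gt_1_nat[OF assms(1)] assms(2) by (intro one_less_power) auto
  then have "norm x < 1"
    by (auto simp: x_def divide_less_eq_1)
  moreover have eq: "x * (1 / (1 - x)) = 1 / (real p ^ t - 1)"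
    using \<open>real p ^ t > 1\<close> prime_gt_0_nat[OF assms(1)] by (auto simp: x_def divide_simps)
  ultimately have "(\<lambda>j. x * x ^ j) sums (x * (1 / (1 - x)))"
    by (intro sums_mult geometric_sums)
  moreover have "x * x ^ j = 1 / real (p ^ Suc j) ^ t" for j
    by (simp add: x_def power_mult_distrib power_divide mult.commute flip: power_mult)
  ultimately show "(\<lambda>j. 1 / real (p ^ Suc j) ^ t) sums (1 / (real p ^ t - 1))"
    by (simp only: eq)
qed simp

text \<open>Induction on the set of primes: a number with prime set \<open>insert p P\<close> is
  uniquely a positive power of \<open>p\<close> times a number with prime set \<open>P\<close>, so
  the sum splits into a geometric series times the sum for \<open>P\<close>.\<close>

lemma has_sum_prime_factors_eq:
  fixes P :: "nat set"
  assumes "t \<ge> 2" "finite P" "\<And>p. p \<in> P \<Longrightarrow> prime p"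
  shows "((\<lambda>m. 1 / real m ^ t) has_sum (\<Prod>p\<in>P. 1 / (real p ^ t - 1)))
           {m. m > 0 \<and> prime_factors m = P}"
  using assms(2,3)
proof (induction P rule: finite_induct)
  case empty
  have "{m :: nat. m > 0 \<and> prime_factors m = {}} = {1}"
    by (auto simp: prime_factorization_empty_iff)
  then show ?case by (simp add: has_sum_finiteI)
next
  case (insert p P)
  define A where "A = {m. m > 0 \<and> prime_factors m = P}"
  define B where "B = {m. m > 0 \<and> prime_factors m = insert p P}"
  have p: "prime p" using insert.prems by simp
  have p0: "p > 0" using p by (simp add: prime_gt_0_nat)
  \<comment> \<open>The inverse recovers \<open>j\<close> as \<open>multiplicity p m - 1\<close>; on
    \<open>B\<close> the multiplicity is positive, so the truncated subtraction is exact.\<close>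
  have bij: "bij_betw (\<lambda>(j, m). p ^ Suc j * m) (UNIV \<times> A) B"
  proof (rule bij_betw_byWitness
      [where f' = "\<lambda>m. (multiplicity p m - 1, m div p ^ multiplicity p m)"])
    have mult: "multiplicity p (p ^ Suc j * m) = Suc j" if "m \<in> A" for j m
    proof -
      have "\<not> p dvd m" using that insert.hyps p by (auto simp: A_def prime_factors_dvd)
      then show ?thesis using p0 by (intro multiplicity_decomposeI[OF refl]) auto
    qed
    show "\<forall>x\<in>UNIV \<times> A. (\<lambda>m. (multiplicity p m - 1, m div p ^ multiplicity p m))
        ((\<lambda>(j, m). p ^ Suc j * m) x) = x"
    proof
      fix x :: "nat \<times> nat" assume "x \<in> UNIV \<times> A"
      then obtain j m where "x = (j, m)" "m \<in> A" by auto
      with mult[of m j] p0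
      show "(\<lambda>m. (multiplicity p m - 1, m div p ^ multiplicity p m))
          ((\<lambda>(j, m). p ^ Suc j * m) x) = x"
        by (simp del: power_Suc)
    qed
    show "(\<lambda>(j, m). p ^ Suc j * m) ` (UNIV \<times> A) \<subseteq> B"
    proof safe
      fix j m assume m: "m \<in> A"
      have "prime_factors (p ^ Suc j) = {p}"
        using p by (simp add: prime_factorization_prime_power del: power_Suc)
      with m p0 show "p ^ Suc j * m \<in> B"
        by (auto simp: A_def B_def prime_factors_product simp del: power_Suc)
    qed
    have dec: "p ^ Suc (multiplicity p m - 1) * (m div p ^ multiplicity p m) = m \<and>
        m div p ^ multiplicity p m \<in> A" if "m \<in> B" for m
    proof -
      have m: "m > 0" "prime_factors m = insert p P" using that by (auto simp: B_def)
      then have "multiplicity p m > 0" by (metis insertI1 prime_factors_multiplicity mem_Collect_eq)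
      then have S: "Suc (multiplicity p m - 1) = multiplicity p m" by simp
      define y where "y = m div p ^ multiplicity p m"
      have my: "m = p ^ multiplicity p m * y" by (simp add: y_def multiplicity_dvd)
      have "\<not> p dvd y" unfolding y_def
        using m p by (intro multiplicity_decompose) auto
      moreover have "y > 0" using m my by (metis gr0I mult_0_right less_irrefl)
      moreover have "prime_factors (p ^ multiplicity p m) = {p}"
        using p \<open>multiplicity p m > 0\<close> by (simp add: prime_factorization_prime_power)
      then have "insert p P = insert p (prime_factors y)"
        using m my p0 \<open>y > 0\<close> prime_factors_product[of "p ^ multiplicity p m" y] by auto
      moreover have "p \<notin> prime_factors y" using \<open>\<not> p dvd y\<close> by auto
      ultimately have "y \<in> A" using insert.hyps by (auto simp: A_def insert_ident)
      then show ?thesis using my unfolding S y_def[symmetric] by simp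
    qed
    then show "\<forall>m\<in>B. (\<lambda>(j, m). p ^ Suc j * m)
        ((\<lambda>m. (multiplicity p m - 1, m div p ^ multiplicity p m)) m) = m" by simp
    show "(\<lambda>m. (multiplicity p m - 1, m div p ^ multiplicity p m)) ` B \<subseteq> UNIV \<times> A"
      using dec by auto
  qed
  define f where "f = (\<lambda>m. 1 / real m ^ t)"
  have "((\<lambda>x. f ((\<lambda>(j, m). p ^ Suc j * m) x)) has_sum
      (1 / (real p ^ t - 1) * (\<Prod>p\<in>P. 1 / (real p ^ t - 1)))) (UNIV \<times> A)"
  proof (rule has_sum_SigmaI)
    fix j :: nat
    have "((\<lambda>m. f (p ^ Suc j) * f m) has_sum (f (p ^ Suc j) * (\<Prod>p\<in>P. 1 / (real p ^ t - 1)))) A"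
      using insert unfolding A_def f_def by (intro has_sum_cmult_right) auto
    then show "((\<lambda>m. f (case (j, m) of (j, m) \<Rightarrow> p ^ Suc j * m)) has_sum
        (f (p ^ Suc j) * (\<Prod>p\<in>P. 1 / (real p ^ t - 1)))) A"
      by (simp add: f_def power_mult_distrib)
  next
    show "((\<lambda>j. f (p ^ Suc j) * (\<Prod>p\<in>P. 1 / (real p ^ t - 1))) has_sum
      (1 / (real p ^ t - 1) * (\<Prod>p\<in>P. 1 / (real p ^ t - 1)))) UNIV"
      unfolding f_def using p assms(1)
      by (intro has_sum_cmult_left has_sum_prime_power_reciprocals) auto
    \<comment> \<open>Passing from iterated to joint sum needs joint summability, which
      \<open>bij\<close> transports from the sum over \<open>B\<close>.\<close>
    show "(\<lambda>x. f ((\<lambda>(j, m). p ^ Suc j * m) x)) summable_on UNIV \<times> A"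
      unfolding summable_on_reindex_bij_betw[OF bij] unfolding f_def
      using assms(1) by (rule summable_on_inverse_power)
  qed
  then have "(f has_sum (1 / (real p ^ t - 1) * (\<Prod>p\<in>P. 1 / (real p ^ t - 1)))) B"
    unfolding has_sum_reindex_bij_betw[OF bij] .
  then show ?case using insert.hyps by (simp add: B_def f_def)
qed

text \<open>For squarefree \<open>q\<close> the power q^t is the product of the p^t, and each
  absorbs its factor 1 - p^-t. The result is the value found in
  \<open>has_sum_prime_factors_eq\<close>.\<close>

lemma inverse_jordan_totient_squarefree:
  assumes "squarefree q"
  shows "1 / jordan_totient t q = (\<Prod>p\<in>prime_factors q. 1 / (real p ^ t - 1))"
proof -
  have "real q ^ t = (\<Prod>p\<in>prime_factors q. real p ^ t)"
    by (subst squarefree_prod_prime_factors[OF assms, symmetric])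
       (simp add: prod_power_distrib)
  then have "jordan_totient t q = (\<Prod>p\<in>prime_factors q. real p ^ t * (1 - 1 / real p ^ t))"
    by (simp add: jordan_totient_def prod.distrib)
  also have "\<dots> = (\<Prod>p\<in>prime_factors q. real p ^ t - 1)"
  proof (rule prod.cong)
    fix p assume "p \<in> prime_factors q"
    then have "p > 0" by (simp add: prime_factors_gt_0_nat)
    then show "real p ^ t * (1 - 1 / real p ^ t) = real p ^ t - 1" by (simp add: field_simps)
  qed simp
  finally show ?thesis by (simp add: prod_dividef)
qed

text \<open>
  The squarefree multiples \<open>q\<close> of \<open>d\<close> index a partition of all positive multiples \<open>m\<close> of \<open>d\<close>
  according to the radical of \<open>m\<close>.
\<close>

lemma has_sum_inverse_jordan_totient_multiples:
  assumes "t \<ge> 2" "squarefree d"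
  shows "((\<lambda>q. 1 / jordan_totient t q) has_sum
           (1 / real d ^ t * (\<Sum>\<^sub>\<infinity>m\<in>{0<..}. 1 / real m ^ t))) {q. squarefree q \<and> d dvd q}"
proof -
  define f where "f = (\<lambda>m. 1 / real m ^ t)"
  define Z where "Z = infsum f {0<..}"
  define Q where "Q = {q. squarefree q \<and> d dvd q}"
  define B where "B q = {m. m > 0 \<and> prime_factors m = prime_factors q}" for q :: nat
  have d0: "d > 0" using assms(2) by (metis gr0I not_squarefree_0)
  \<comment> \<open>Scaling by \<open>d\<close> maps the positive integers onto the positive
    multiples of \<open>d\<close>, and \<open>f (d * m) = f d * f m\<close>; these multiples
    therefore contribute \<open>f d * Z\<close>.\<close>
  have "(f has_sum Z) {0<..}"
    unfolding Z_def f_def by (intro has_sum_infsum summable_on_inverse_power assms)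
  then have "((\<lambda>m. f d * f m) has_sum (f d * Z)) {0<..}"
    by (rule has_sum_cmult_right)
  then have "((\<lambda>m. f (d * m)) has_sum (f d * Z)) {0<..}"
    by (simp add: f_def power_mult_distrib)
  moreover have "bij_betw (\<lambda>m. d * m) {0<..} {m. m > 0 \<and> d dvd m}"
    using d0 by (auto simp: bij_betw_def inj_on_def elim!: dvdE)
  ultimately have *: "(f has_sum (f d * Z)) {m. m > 0 \<and> d dvd m}"
    using has_sum_reindex_bij_betw by blast
  \<comment> \<open>The inverse pairs \<open>m\<close> with its radical, which \<open>d\<close>
    divides because \<open>d\<close> is squarefree and divides \<open>m\<close>.\<close>
  have bij: "bij_betw snd (Sigma Q B) {m. m > 0 \<and> d dvd m}"
  proof (rule bij_betw_byWitness[where f' = "\<lambda>m. (\<Prod>(prime_factors m), m)"])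
    have Q0: "q > 0" if "q \<in> Q" for q using that by (metis Q_def mem_Collect_eq gr0I not_squarefree_0)
    show "\<forall>x\<in>Sigma Q B. (\<Prod>(prime_factors (snd x)), snd x) = x"
      by (auto simp: Q_def B_def squarefree_prod_prime_factors)
    show "snd ` Sigma Q B \<subseteq> {m. m > 0 \<and> d dvd m}"
    proof safe
      fix q m assume qm: "q \<in> Q" "m \<in> B q"
      then show "snd (q, m) > 0" by (simp add: B_def)
      show "d dvd snd (q, m)"
        using qm Q0[of q] squarefree_dvd_iff_prime_factors_subset[OF assms(2), of q]
          squarefree_dvd_iff_prime_factors_subset[OF assms(2), of m]
        by (simp add: Q_def B_def)
    qed
    show "(\<lambda>m. (\<Prod>(prime_factors m), m)) ` {m. m > 0 \<and> d dvd m} \<subseteq> Sigma Q B"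
    proof safe
      fix m assume m: "m > 0" "d dvd m"
      have pf: "prime_factors (\<Prod>(prime_factors m)) = prime_factors m"
        by (rule prime_factors_prod_primes) auto
      have sf: "squarefree (\<Prod>(prime_factors m))"
        by (rule squarefree_prod_primes) auto
      have "\<Prod>(prime_factors m) > 0" by (intro prod_pos ballI prime_factors_gt_0_nat)
      then have "d dvd \<Prod>(prime_factors m)"
        using squarefree_dvd_iff_prime_factors_subset[OF assms(2)] pf m by blast
      then show "\<Prod>(prime_factors m) \<in> Q" "m \<in> B (\<Prod>(prime_factors m))"
        using pf sf m by (auto simp: Q_def B_def)
    qed
  qed simp
  have "((\<lambda>x. f (snd x)) has_sum (f d * Z)) (Sigma Q B)"
    using * unfolding has_sum_reindex_bij_betw[OF bij] .
  \<comment> \<open>The joint sum exists, so it may be evaluated fibre by fibre; the fibre over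
    \<open>q\<close> sums to 1/J_t(q).\<close>
  then have "((\<lambda>q. 1 / jordan_totient t q) has_sum (f d * Z)) Q"
  proof (rule has_sum_SigmaD)
    fix q assume "q \<in> Q"
    then have "squarefree q" by (simp add: Q_def)
    then show "((\<lambda>m. f (snd (q, m))) has_sum (1 / jordan_totient t q)) (B q)"
      unfolding inverse_jordan_totient_squarefree[OF \<open>squarefree q\<close>] B_def f_def snd_conv
      by (intro has_sum_prime_factors_eq assms) auto
  qed
  then show ?thesis by (simp add: Q_def Z_def f_def)
qed

section \<open>Zeta values at integers\<close>

lemma riemann_zeta_of_nat:
  assumes "t \<ge> 2"
  shows "riemann_zeta (of_nat t) = of_real (\<Sum>\<^sub>\<infinity>m\<in>{0<..}. 1 / real m ^ t)"
proof -
  have "((\<lambda>m. 1 / real m ^ t) has_sum (\<Sum>\<^sub>\<infinity>m\<in>{0<..}. 1 / real m ^ t)) {0<..}"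
    by (intro has_sum_infsum summable_on_inverse_power assms)
  moreover have "bij_betw Suc UNIV {0<..}"
    by (simp add: bij_betw_def flip: greaterThan_0)
  ultimately have "((\<lambda>n. 1 / real (Suc n) ^ t) has_sum (\<Sum>\<^sub>\<infinity>m\<in>{0<..}. 1 / real m ^ t)) UNIV"
    using has_sum_reindex_bij_betw by fast
  then have "(\<lambda>n. complex_of_real (1 / real (Suc n) ^ t)) sums
      of_real (\<Sum>\<^sub>\<infinity>m\<in>{0<..}. 1 / real m ^ t)"
    by (intro has_sum_imp_sums has_sum_of_real)
  moreover have "complex_of_real (1 / real (Suc n) ^ t) = 1 / of_nat (Suc n) powr of_nat t" for n
    by (subst powr_nat') (simp_all del: of_nat_Suc)
  ultimately show ?thesis by (simp add: riemann_zeta_def sums_iff)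
qed

text \<open>The term \<open>m = 1\<close> alone bounds the sum from below. Positivity is what
  permits division by the zeta value.\<close>

lemma infsum_inverse_power_pos:
  assumes "t \<ge> 2"
  shows "(\<Sum>\<^sub>\<infinity>m\<in>{0<..}. 1 / real m ^ t) > 0"
proof -
  have "(\<Sum>m\<in>{1}. 1 / real m ^ t) \<le> (\<Sum>\<^sub>\<infinity>m\<in>{0<..}. 1 / real m ^ t)"
    by (intro finite_sum_le_infsum summable_on_inverse_power assms) auto
  then show ?thesis by simp
qed

section \<open>Interchange of summations and evaluation of the series\<close>

lemma has_sum_sum_finite:
  fixes f :: "'i \<Rightarrow> 'a \<Rightarrow> 'b :: topological_comm_monoid_add"
  assumes "\<And>i. i \<in> I \<Longrightarrow> (f i has_sum S i) A"
  shows "((\<lambda>x. \<Sum>i\<in>I. f i x) has_sum (\<Sum>i\<in>I. S i)) A"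
  using assms by (induction I rule: infinite_finite_induct) (auto intro: has_sum_add)

text \<open>By \<open>moebius_mu_mult_div\<close> the coefficients become mu(d), so the term is a
  sum over the divisors of \<open>n\<close>, a finite index set independent of \<open>q\<close>. If
  \<open>q\<close> is not squarefree, both sides vanish.\<close>

lemma moebius_mu_cohen_ramanujan_term:
  assumes "s \<ge> 1" "q > 0" "n > 0"
  shows "of_int (moebius_mu q) / of_real (jordan_totient t q) * cohen_ramanujan s q (int n ^ s) =
    complex_of_real (\<Sum>d | d dvd n. of_int (moebius_mu d) * real d ^ s *
      (if squarefree q \<and> d dvd q then 1 / jordan_totient t q else 0))"
proof (cases "squarefree q")
  case True
  have "of_int (moebius_mu q) * cohen_ramanujan s q (int n ^ s) =
      (\<Sum>d | d dvd q. of_int (moebius_mu d) * (if d dvd n then of_nat d ^ s else 0))"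
    unfolding cohen_ramanujan_eq_divisor_sum[OF assms(1,2)] sum_distrib_left
  proof (rule sum.cong)
    fix d assume "d \<in> {d. d dvd q}"
    then have "moebius_mu d = moebius_mu q * moebius_mu (q div d)"
      using moebius_mu_mult_div[OF True] by simp
    then show "of_int (moebius_mu q) * (of_int (moebius_mu (q div d)) *
        (if d dvd n then of_nat d ^ s else 0)) =
        (of_int (moebius_mu d) * (if d dvd n then of_nat d ^ s else 0) :: complex)"
      by simp
  qed simp
  \<comment> \<open>The index set moves from divisors of \<open>q\<close> to divisors of
    \<open>n\<close> through the common divisors.\<close>
  also have "\<dots> = (\<Sum>d | d dvd q \<and> d dvd n. of_int (moebius_mu d) * of_nat d ^ s)"
    using assms by (intro sum.mono_neutral_cong_right) auto
  also have "\<dots> = (\<Sum>d | d dvd n. of_int (moebius_mu d) * of_nat d ^ s * (if d dvd q then 1 else 0))"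
    using assms by (intro sum.mono_neutral_cong_left) auto
  finally have *: "of_int (moebius_mu q) * cohen_ramanujan s q (int n ^ s) = \<dots>" .
  have "of_int (moebius_mu q) / of_real (jordan_totient t q) * cohen_ramanujan s q (int n ^ s) =
      (of_int (moebius_mu q) * cohen_ramanujan s q (int n ^ s)) * (1 / of_real (jordan_totient t q))"
    by simp
  also have "\<dots> = (\<Sum>d | d dvd n. of_int (moebius_mu d) * of_nat d ^ s *
      (if squarefree q \<and> d dvd q then 1 / of_real (jordan_totient t q) else 0))"
    unfolding * sum_distrib_right using True by (intro sum.cong) auto
  also have "\<dots> = complex_of_real (\<Sum>d | d dvd n. of_int (moebius_mu d) * real d ^ s *
      (if squarefree q \<and> d dvd q then 1 / jordan_totient t q else 0))"
    unfolding of_real_sum by (intro sum.cong) auto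
  finally show ?thesis .
qed (simp add: moebius_mu_def)

theorem theorem3p5:
  fixes s k n :: nat
  assumes "s \<ge> 1" and "k \<ge> 1" and "n \<ge> 1"
  shows "(\<lambda>j. let q = Suc j in
            of_int (moebius_mu q)
              / (riemann_zeta (of_nat (s + k)) * of_real (jordan_totient (s + k) q))
              * cohen_ramanujan s q (int n ^ s))
         sums complex_of_real (jordan_totient k n / real n ^ k)"
proof -
  define t where "t = s + k"
  define Z where "Z = (\<Sum>\<^sub>\<infinity>m\<in>{0<..}. 1 / real m ^ t)"
  have t: "t \<ge> 2" using assms by (simp add: t_def)
  have Z: "Z > 0" unfolding Z_def using t by (rule infsum_inverse_power_pos)
  define g where "g d q = of_int (moebius_mu d) * real d ^ s *
      (if squarefree q \<and> d dvd q then 1 / jordan_totient t q else 0)" for d q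
  \<comment> \<open>For fixed \<open>d\<close> the sum over \<open>q\<close> gives d^s d^-t = d^-k
    times mu(d) \<open>Z\<close>.\<close>
  have g: "(g d has_sum (of_int (moebius_mu d) * (1 / real d ^ k) * Z)) {0<..}" if "d dvd n" for d
  proof (cases "squarefree d")
    case True
    have "d > 0" using that assms by (auto intro: gr0I)
    \<comment> \<open>Extension by zero from the squarefree multiples of \<open>d\<close> to all
      positive \<open>q\<close>; 0 is not squarefree, so no index is lost.\<close>
    have "((\<lambda>q. if squarefree q \<and> d dvd q then 1 / jordan_totient t q else 0) has_sum
        (1 / real d ^ t * Z)) {0<..}"
      using has_sum_inverse_jordan_totient_multiples[OF t True] unfolding Z_def[symmetric]
      by (rule has_sum_cong_neutral[THEN iffD1, rotated -1]) (auto intro: gr0I)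
    then have "(g d has_sum (of_int (moebius_mu d) * real d ^ s * (1 / real d ^ t * Z))) {0<..}"
      unfolding g_def by (rule has_sum_cmult_right)
    moreover have "real d ^ s * (1 / real d ^ t) = 1 / real d ^ k"
      using \<open>d > 0\<close> by (simp add: t_def power_add)
    ultimately show ?thesis by (metis mult.assoc)
  next
    case False
    then have "g d = (\<lambda>_. 0)" "moebius_mu d = 0" by (auto simp: g_def moebius_mu_def)
    then show ?thesis by simp
  qed
  have "((\<lambda>q. \<Sum>d | d dvd n. g d q) has_sum
      (\<Sum>d | d dvd n. of_int (moebius_mu d) * (1 / real d ^ k) * Z)) {0<..}"
    using g by (intro has_sum_sum_finite) auto
  \<comment> \<open>The Moebius product formula with f(d) = d^-k gives the Euler factors of
    J_k(n).\<close>
  also have "(\<Sum>d | d dvd n. of_int (moebius_mu d) * (1 / real d ^ k) * Z) =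
      (\<Prod>p\<in>prime_factors n. 1 - 1 / real p ^ k) * Z"
    unfolding sum_distrib_right[symmetric] using assms
    by (subst sum_moebius_mu_multiplicative) (auto simp: power_mult_distrib)
  also have "(\<Prod>p\<in>prime_factors n. 1 - 1 / real p ^ k) = jordan_totient k n / real n ^ k"
    using assms by (simp add: jordan_totient_def)
  finally have "((\<lambda>q. (\<Sum>d | d dvd n. g d q) * (1 / Z)) has_sum
      (jordan_totient k n / real n ^ k * Z * (1 / Z))) {0<..}"
    by (rule has_sum_cmult_left)
  moreover have "bij_betw Suc UNIV {0<..}"
    by (simp add: bij_betw_def flip: greaterThan_0)
  ultimately have "((\<lambda>j. (\<Sum>d | d dvd n. g d (Suc j)) * (1 / Z)) has_sum
      (jordan_totient k n / real n ^ k)) UNIV"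
    using Z has_sum_reindex_bij_betw[of Suc UNIV "{0<..}" "\<lambda>q. (\<Sum>d | d dvd n. g d q) * (1 / Z)"]
    by simp
  \<comment> \<open>Unconditional summability implies convergence in the order q = 1, 2, ..., with
    \<open>q = Suc j\<close>.\<close>
  then have "(\<lambda>j. complex_of_real ((\<Sum>d | d dvd n. g d (Suc j)) * (1 / Z))) sums
      complex_of_real (jordan_totient k n / real n ^ k)"
    by (intro has_sum_imp_sums has_sum_of_real)
  moreover have "complex_of_real ((\<Sum>d | d dvd n. g d q) * (1 / Z)) =
      of_int (moebius_mu q) / (riemann_zeta (of_nat (s + k)) * of_real (jordan_totient (s + k) q))
        * cohen_ramanujan s q (int n ^ s)" if "q > 0" for q
  proof -
    have "complex_of_real ((\<Sum>d | d dvd n. g d q) * (1 / Z)) =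
        of_int (moebius_mu q) / of_real (jordan_totient t q) * cohen_ramanujan s q (int n ^ s) *
          (1 / of_real Z)"
      using moebius_mu_cohen_ramanujan_term[of s q n t] that assms by (simp add: g_def)
    also have "complex_of_real Z = riemann_zeta (of_nat (s + k))"
      using riemann_zeta_of_nat[OF t] by (simp add: Z_def t_def)
    finally show ?thesis by (simp add: t_def mult_ac)
  qed
  ultimately show ?thesis by (simp add: Let_def)
qed

end
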